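(* Let $\Pi$ be the groupoid with its automorphisms $h_1,h_2,h_3$, and let $h_{k*}:[\rho]\mapsto[\rho\circ h_k]$ be the induced maps on equivalence classes of representations $\rho:\Pi\to\mathrm{SL}_2(\mathbb{C})$, as defined in the context. Let $a_1,a_2,a_3,a_4,x_{1,2},x_{2,3},x_{1,3}$ be the trace coordinates of $[\rho]$, and let $x'_{i,j}$ be the corresponding trace coordinates of $h_{1*}[\rho]$. Then $$x'_{1,2}=x_{1,2},$$ $$x'_{2,3}=-x_{1,2}x_{1,3}-x_{2,3}+(a_1a_4+a_2a_3),$$ $$x'_{1,3}=x_{1,2}^2x_{1,3}+x_{1,2}x_{2,3}-x_{1,3}-x_{1,2}(a_1a_4+a_2a_3)+(a_1a_3+a_2a_4).$$ The analogous formulas for $h_{2*}$ and $h_{3*}$ are obtained from these by applying once, respectively twice, the cyclic permutation $1\mapsto2\mapsto3\mapsto1$ to the indices $1,2,3$ (the index $4$ being fixed, and with $x_{i,j}=x_{j,i}$).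
   Context: Groupoid. $\Pi$ is the groupoid with objects $s_1,s_2,s_3$, freely generated by the morphisms $\gamma_{i,i}$ ($i=1,2,3$) from $s_i$ to $s_i$, $\gamma_{1,2}$ from $s_1$ to $s_2$ and $\gamma_{2,3}$ from $s_2$ to $s_3$. Products are written in the order of travel: $\gamma\gamma'$ means $\gamma$ followed by $\gamma'$. Put $\gamma_{3,1}=(\gamma_{1,2}\gamma_{2,3})^{-1}$ and $\gamma_{j,i}=\gamma_{i,j}^{-1}$ for $i\neq j$. (This is the full subgroupoid on the base points $s_1,s_2,s_3$ of the fundamental groupoid, with four base points, of the Riemann sphere with four holes, each base point on the boundary of a hole; $\gamma_{i,i}$ is the loop around the $i$-th hole, and the fourth loop $\gamma_{4,4}$ is determined by $\gamma_{1,1}\gamma_{1,2}\gamma_{2,2}\gamma_{2,3}\gamma_{3,3}\gamma_{3,4}\gamma_{4,4}\gamma_{4,1}=1$ and $\gamma_{1,2}\gamma_{2,3}\gamma_{3,4}\gamma_{4,1}=1$.) Automorphisms. $h_1$ is the automorphism of $\Pi$ fixing the objects with $h_1(\gamma_{i,i})=\gamma_{i,i}$ for all $i$, $h_1(\gamma_{1,2})=\gamma_{1,2}$ and $h_1(\gamma_{3,2})=\gamma_{3,2}\gamma_{2,1}\gamma_{1,1}\gamma_{1,2}\gamma_{2,2}$ (the action of a pure braid generator $b_1$ between $s_1$ and $s_2$). $h_2$ and $h_3$ are obtained by cyclically permuting the indices $1\to2\to3\to1$: $h_2$ fixes all $\gamma_{i,i}$ and $\gamma_{2,3}$, and $h_2(\gamma_{1,3})=\gamma_{1,3}\gamma_{3,2}\gamma_{2,2}\gamma_{2,3}\gamma_{3,3}$;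 $h_3$ fixes all $\gamma_{i,i}$ and $\gamma_{3,1}$, and $h_3(\gamma_{2,1})=\gamma_{2,1}\gamma_{1,3}\gamma_{3,3}\gamma_{3,1}\gamma_{1,1}$. Representations. A representation $\rho:\Pi\to \mathrm{SL}_2(\mathbb{C})$ is a groupoid morphism, with $\rho(\gamma\gamma')=\rho(\gamma)\rho(\gamma')$. Two representations $\rho,\rho'$ are equivalent if there are $N_1,N_2,N_3\in\mathrm{SL}_2(\mathbb{C})$ such that $\rho'(\gamma)=N_i\rho(\gamma)N_j^{-1}$ for every morphism $\gamma$ from $s_i$ to $s_j$. Every class $[\rho]$ contains a normalized representation, i.e. one with $\rho(\gamma_{1,2})=\rho(\gamma_{2,3})=I$; it is unique up to a common conjugation of the three matrices $M_i=\rho(\gamma_{i,i})$. The trace coordinates of $[\rho]$ are, computed from a normalized representative, $a_i=\operatorname{tr}(M_i)$ ($i=1,2,3$), $a_4=\operatorname{tr}(M_1M_2M_3)$, $x_{i,j}=\operatorname{tr}(M_iM_j)$ for $i\neq j$. For $h_{k*}[\rho]$ they are computed from a normalized representative of $[\rho\circ h_k]$. *)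

theory Defs
  imports "HOL-Analysis.Analysis"
begin

section \<open>The free groupoid\<close>

datatype obj = S1 | S2 | S3

text \<open>The free generators: \<open>Loop i\<close> is the loop at the \<open>i\<close>-th object, \<open>E12\<close> and \<open>E23\<close> are the
  connecting generators from \<open>S1\<close> to \<open>S2\<close> and from \<open>S2\<close> to \<open>S3\<close>.\<close>

datatype edge = Loop obj | E12 | E23

fun esource :: "edge \<Rightarrow> obj" where
  "esource (Loop i) = i"
| "esource E12 = S1"
| "esource E23 = S2"

fun etarget :: "edge \<Rightarrow> obj" where
  "etarget (Loop i) = i"
| "etarget E12 = S2"
| "etarget E23 = S3"

text \<open>A letter \<open>(e, True)\<close> is the generator \<open>e\<close>, the letter \<open>(e, False)\<close> its formal inverse.\<close>

type_synonym letter = "edge \<times> bool"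

definition lsource :: "letter \<Rightarrow> obj" where
  "lsource l = (if snd l then esource (fst l) else etarget (fst l))"

definition ltarget :: "letter \<Rightarrow> obj" where
  "ltarget l = (if snd l then etarget (fst l) else esource (fst l))"

definition linv :: "letter \<Rightarrow> letter" where
  "linv l = (fst l, \<not> snd l)"

fun is_path :: "obj \<Rightarrow> letter list \<Rightarrow> obj \<Rightarrow> bool" where
  "is_path i [] j \<longleftrightarrow> i = j"
| "is_path i (l # w) j \<longleftrightarrow> lsource l = i \<and> is_path (ltarget l) w j"

text \<open>The equivalence generated by cancelling adjacent mutually inverse letters in a path.\<close>

inductive path_eq :: "obj \<Rightarrow> obj \<Rightarrow> letter list \<Rightarrow> letter list \<Rightarrow> bool" for i j where
  refl: "is_path i w j \<Longrightarrow> path_eq i j w w"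
| cancel: "is_path i (u @ l # linv l # v) j \<Longrightarrow> path_eq i j (u @ l # linv l # v) (u @ v)"
| sym: "path_eq i j v w \<Longrightarrow> path_eq i j w v"
| trans: "path_eq i j u v \<Longrightarrow> path_eq i j v w \<Longrightarrow> path_eq i j u w"

definition arrow_rel :: "obj \<times> letter list \<times> obj \<Rightarrow> obj \<times> letter list \<times> obj \<Rightarrow> bool" where
  "arrow_rel = (\<lambda>(i, v, j) (i', w, j'). i = i' \<and> j = j' \<and> path_eq i j v w)"

lemma is_path_append: "is_path i (u @ v) j \<longleftrightarrow> (\<exists>k. is_path i u k \<and> is_path k v j)"
  by (induction u arbitrary: i) auto

lemma lsource_linv [simp]: "lsource (linv l) = ltarget l"
  and ltarget_linv [simp]: "ltarget (linv l) = lsource l"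
  and linv_linv [simp]: "linv (linv l) = l"
  by (auto simp: lsource_def ltarget_def linv_def)

lemma path_eq_is_path: "path_eq i j v w \<Longrightarrow> is_path i v j \<and> is_path i w j"
  by (induction rule: path_eq.induct) (auto simp: is_path_append)

lemma part_equivp_arrow_rel: "part_equivp arrow_rel"
proof (rule part_equivpI)
  show "\<exists>x. arrow_rel x x"
    by (rule exI[of _ "(S1, [], S1)"]) (auto simp: arrow_rel_def intro: path_eq.refl)
  show "symp arrow_rel"
    by (auto simp: arrow_rel_def symp_def intro: path_eq.sym)
  show "transp arrow_rel"
    unfolding transp_def by (auto simp: arrow_rel_def intro: path_eq.trans)
qed

text \<open>The morphisms of the free groupoid.\<close>

quotient_type arrow = "obj \<times> letter list \<times> obj" / partial: arrow_rel
  by (rule part_equivp_arrow_rel)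

lemma path_eq_append:
  assumes "path_eq i j u u'" "path_eq j k v v'"
  shows "path_eq i k (u @ v) (u' @ v')"
proof -
  have 1: "path_eq i k (u @ w) (u' @ w)" if "is_path j w k" for w
    using assms(1) that
  proof (induction rule: path_eq.induct)
    case (cancel u l v)
    have "is_path i (u @ l # linv l # (v @ w)) k"
      using cancel by (auto simp: is_path_append)
    from path_eq.cancel[OF this] show ?case by simp
  next
    case (refl w')
    then show ?case by (intro path_eq.refl) (auto simp: is_path_append)
  next
    case (sym v w)
    show ?case by (rule path_eq.sym[OF sym.IH[OF sym.prems]])
  next
    case (trans u v w)
    show ?case by (rule path_eq.trans[OF trans.IH(1)[OF trans.prems] trans.IH(2)[OF trans.prems]])
  qed
  have 2: "path_eq i k (w @ v) (w @ v')" if "is_path i w j" for w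
    using assms(2) that
  proof (induction rule: path_eq.induct)
    case (cancel u l v)
    have "is_path i ((w @ u) @ l # linv l # v) k"
      using cancel by (auto simp: is_path_append)
    from path_eq.cancel[OF this] show ?case by simp
  next
    case (refl w')
    then show ?case by (intro path_eq.refl) (auto simp: is_path_append)
  next
    case (sym v w)
    show ?case by (rule path_eq.sym[OF sym.IH[OF sym.prems]])
  next
    case (trans u v w)
    show ?case by (rule path_eq.trans[OF trans.IH(1)[OF trans.prems] trans.IH(2)[OF trans.prems]])
  qed
  show ?thesis
    using 1 2 path_eq_is_path[OF assms(1)] path_eq_is_path[OF assms(2)]
    by (meson path_eq.trans)
qed

definition winv :: "letter list \<Rightarrow> letter list" where
  "winv w = rev (map linv w)"

lemma is_path_winv: "is_path i w j \<Longrightarrow> is_path j (winv w) i"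
  by (induction w arbitrary: i) (auto simp: winv_def is_path_append)

lemma winv_append: "winv (v @ w) = winv w @ winv v"
  by (simp add: winv_def)

lemma winv_winv: "winv (winv w) = w"
  by (induction w) (simp_all add: winv_def)

lemma path_eq_winv: "path_eq i j v w \<Longrightarrow> path_eq j i (winv v) (winv w)"
proof (induction rule: path_eq.induct)
  case (cancel u l v)
  from is_path_winv[OF this] have "is_path j (winv v @ l # linv l # winv u) i"
    by (simp add: winv_def)
  from path_eq.cancel[OF this] show ?case by (simp add: winv_def)
next
  case (refl w)
  then show ?case by (intro path_eq.refl is_path_winv)
next
  case (sym v w)
  show ?case by (rule path_eq.sym[OF sym.IH])
next
  case (trans u v w)
  show ?case by (rule path_eq.trans[OF trans.IH])
qed

lift_definition source :: "arrow \<Rightarrow> obj" is "\<lambda>(i, w, j). i"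
  by (auto simp: arrow_rel_def)

lift_definition target :: "arrow \<Rightarrow> obj" is "\<lambda>(i, w, j). j"
  by (auto simp: arrow_rel_def)

lift_definition ident :: "obj \<Rightarrow> arrow" is "\<lambda>i. (i, [], i)"
  by (auto simp: arrow_rel_def intro: path_eq.refl)

lift_definition generator :: "edge \<Rightarrow> arrow" is "\<lambda>e. (esource e, [(e, True)], etarget e)"
  by (auto simp: arrow_rel_def lsource_def ltarget_def intro: path_eq.refl)

text \<open>\<open>g \<cdot> h\<close> is \<open>g\<close> followed by \<open>h\<close>.  It is meaningful only if \<open>target g = source h\<close>; otherwise
  its value is the dummy \<open>g\<close>.\<close>

lift_definition gcomp :: "arrow \<Rightarrow> arrow \<Rightarrow> arrow" (infixr "\<cdot>" 70)
  is "\<lambda>(i, v, j) (i', w, j'). if j = i' then (i, v @ w, j') else (i, v, j)"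
  by (auto simp: arrow_rel_def intro: path_eq_append split: if_splits)

lift_definition ginv :: "arrow \<Rightarrow> arrow" is "\<lambda>(i, w, j). (j, winv w, i)"
  by (auto simp: arrow_rel_def intro: path_eq_winv)

fun \<gamma> :: "obj \<Rightarrow> obj \<Rightarrow> arrow" where
  "\<gamma> S1 S1 = generator (Loop S1)"
| "\<gamma> S2 S2 = generator (Loop S2)"
| "\<gamma> S3 S3 = generator (Loop S3)"
| "\<gamma> S1 S2 = generator E12"
| "\<gamma> S2 S3 = generator E23"
| "\<gamma> S3 S1 = ginv (generator E12 \<cdot> generator E23)"
| "\<gamma> S2 S1 = ginv (generator E12)"
| "\<gamma> S3 S2 = ginv (generator E23)"
| "\<gamma> S1 S3 = ginv (ginv (generator E12 \<cdot> generator E23))"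


subsection \<open>Groupoid laws\<close>

lemma source_ident [simp]: "source (ident i) = i"
  and target_ident [simp]: "target (ident i) = i"
  by (transfer, simp)+

lemma source_generator [simp]: "source (generator e) = esource e"
  and target_generator [simp]: "target (generator e) = etarget e"
  by (transfer, simp)+

lemma source_ginv [simp]: "source (ginv g) = target g"
  and target_ginv [simp]: "target (ginv g) = source g"
  by (transfer, auto)+

lemma source_comp [simp]: "source (g \<cdot> h) = source g"
  by transfer auto

lemma target_comp [simp]: "target g = source h \<Longrightarrow> target (g \<cdot> h) = target h"
  by transfer auto

lemma gcomp_assoc [simp]:
  "target f = source g \<Longrightarrow> target g = source h \<Longrightarrow> (f \<cdot> g) \<cdot> h = f \<cdot> (g \<cdot> h)"
  by transfer (clarsimp simp: arrow_rel_def split: prod.splits, metis path_eq_append)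

lemma ident_comp [simp]: "source g = i \<Longrightarrow> ident i \<cdot> g = g"
  by transfer (auto simp: arrow_rel_def)

lemma gcomp_ident [simp]: "target g = i \<Longrightarrow> g \<cdot> ident i = g"
  by transfer (auto simp: arrow_rel_def)

lemma winv_right: "is_path i w j \<Longrightarrow> path_eq i i (w @ winv w) []"
proof (induction w arbitrary: i)
  case Nil
  then show ?case by (auto simp: winv_def intro: path_eq.refl)
next
  case (Cons l w)
  let ?k = "ltarget l"
  have l: "is_path i [l] ?k" "is_path ?k [linv l] i" using Cons.prems by auto
  have "path_eq ?k ?k (w @ winv w) []" using Cons by auto
  from path_eq_append[OF path_eq_append[OF path_eq.refl[OF l(1)] this] path_eq.refl[OF l(2)]]
  have "path_eq i i ((l # w) @ winv (l # w)) [l, linv l]" by (simp add: winv_def)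
  moreover have "path_eq i i [l, linv l] []"
    using path_eq.cancel[of i "[]" l "[]" i] l by simp
  ultimately show ?case by (rule path_eq.trans)
qed

lemma gcomp_ginv [simp]: "g \<cdot> ginv g = ident (source g)"
  by transfer (clarsimp simp: arrow_rel_def split: prod.splits, metis path_eq_is_path winv_right)

lemma ginv_ginv [simp]: "ginv (ginv g) = g"
  by transfer (clarsimp simp: winv_winv split: prod.splits)

lemma ginv_comp [simp]: "ginv g \<cdot> g = ident (target g)"
  using gcomp_ginv[of "ginv g"] by simp

lemma ginv_distrib [simp]: "target g = source h \<Longrightarrow> ginv (g \<cdot> h) = ginv h \<cdot> ginv g"
  by transfer
     (clarsimp simp: arrow_rel_def winv_append split: prod.splits,
      metis path_eq_append path_eq_winv)

lemma ginv_ident [simp]: "ginv (ident i) = ident i"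
  by transfer (auto simp: arrow_rel_def winv_def intro: path_eq.refl)

lemma gcomp_ginv_left [simp]: "source g = source h \<Longrightarrow> g \<cdot> ginv g \<cdot> h = h"
  using gcomp_assoc[of g "ginv g" h] by simp

lemma ginv_comp_left [simp]: "target g = source h \<Longrightarrow> ginv g \<cdot> g \<cdot> h = h"
  using gcomp_assoc[of "ginv g" g h] by simp

lemma source_gamma [simp]: "source (\<gamma> i j) = i"
  and target_gamma [simp]: "target (\<gamma> i j) = j"
  by (cases i; cases j; simp)+


section \<open>The automorphisms\<close>

definition endomorphism :: "(arrow \<Rightarrow> arrow) \<Rightarrow> bool" where
  "endomorphism h \<longleftrightarrow>
     (\<forall>g. source (h g) = source g \<and> target (h g) = target g) \<and>
     (\<forall>g g'. target g = source g' \<longrightarrow> h (g \<cdot> g') = h g \<cdot> h g')"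

text \<open>Automorphisms of the groupoid fixing the objects.\<close>

definition automorphism :: "(arrow \<Rightarrow> arrow) \<Rightarrow> bool" where
  "automorphism h \<longleftrightarrow> endomorphism h \<and> bij h"

text \<open>The defining properties of \<open>h\<^sub>1\<close> for \<open>(i, j, k) = (S1, S2, S3)\<close>, and of \<open>h\<^sub>2\<close>, \<open>h\<^sub>3\<close> for the
  cyclic permutations of this triple.\<close>

definition braid_aut :: "obj \<Rightarrow> obj \<Rightarrow> obj \<Rightarrow> (arrow \<Rightarrow> arrow) \<Rightarrow> bool" where
  "braid_aut i j k h \<longleftrightarrow>
     automorphism h \<and> (\<forall>l. h (\<gamma> l l) = \<gamma> l l) \<and> h (\<gamma> i j) = \<gamma> i j \<and>
     h (\<gamma> k j) = \<gamma> k j \<cdot> \<gamma> j i \<cdot> \<gamma> i i \<cdot> \<gamma> i j \<cdot> \<gamma> j j"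

definition h1 :: "arrow \<Rightarrow> arrow" where "h1 = (THE h. braid_aut S1 S2 S3 h)"
definition h2 :: "arrow \<Rightarrow> arrow" where "h2 = (THE h. braid_aut S2 S3 S1 h)"
definition h3 :: "arrow \<Rightarrow> arrow" where "h3 = (THE h. braid_aut S3 S1 S2 h)"

subsection \<open>Existence and uniqueness of \<open>h\<^sub>1\<close>, \<open>h\<^sub>2\<close>, \<open>h\<^sub>3\<close>\<close>

lemma endo_source [simp]: "endomorphism h \<Longrightarrow> source (h g) = source g"
  and endo_target [simp]: "endomorphism h \<Longrightarrow> target (h g) = target g"
  and endo_comp: "endomorphism h \<Longrightarrow> target g = source g' \<Longrightarrow> h (g \<cdot> g') = h g \<cdot> h g'"
  by (auto simp: endomorphism_def)

lemma endo_ident: assumes "endomorphism h" shows "h (ident i) = ident i"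
proof -
  let ?e = "h (ident i)"
  have "?e = ?e \<cdot> ?e" using endo_comp[OF assms, of "ident i" "ident i"] by simp
  then have "?e \<cdot> ginv ?e = (?e \<cdot> ?e) \<cdot> ginv ?e" by simp
  then show ?thesis using assms by simp
qed

lemma endo_ginv: assumes "endomorphism h" shows "h (ginv g) = ginv (h g)"
proof -
  have "h g \<cdot> h (ginv g) = ident (source g)"
    using endo_comp[OF assms, of g "ginv g"] endo_ident[OF assms] by simp
  then have "ginv (h g) \<cdot> h g \<cdot> h (ginv g) = ginv (h g)" using assms by simp
  then show ?thesis using assms by simp
qed

lemma arrow_induct:
  assumes "\<And>i. P (ident i)"
    and "\<And>e g. etarget e = source g \<Longrightarrow> P g \<Longrightarrow> P (generator e \<cdot> g)"
    and "\<And>e g. esource e = source g \<Longrightarrow> P g \<Longrightarrow> P (ginv (generator e) \<cdot> g)"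
  shows "P g"
proof -
  have abs: "Quotient3 arrow_rel abs_arrow rep_arrow" by (rule Quotient3_arrow)
  have main: "is_path i w j \<Longrightarrow> P (abs_arrow (i, w, j))" for i w j
  proof (induction w arbitrary: i)
    case Nil
    then show ?case using assms(1)[of i] by (simp add: ident_def)
  next
    case (Cons l w)
    let ?k = "ltarget l" and ?g = "abs_arrow (ltarget l, w, j)"
    have r: "arrow_rel (?k, w, j) (?k, w, j)"
      using Cons.prems by (auto simp: arrow_rel_def intro: path_eq.refl)
    have s: "source ?g = ?k" using r by (simp add: source.abs_eq)
    have IH: "P ?g" using Cons by auto
    obtain e b where l: "l = (e, b)" by (cases l)
    have re: "arrow_rel (esource e, [(e, True)], etarget e) (esource e, [(e, True)], etarget e)"
      by (auto simp: arrow_rel_def lsource_def ltarget_def intro: path_eq.refl)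
    show ?case
    proof (cases b)
      case True
      have "generator e \<cdot> ?g = abs_arrow (i, l # w, j)"
        using Cons.prems r re True l
        by (simp add: generator.abs_eq gcomp.abs_eq ltarget_def lsource_def)
      then show ?thesis using assms(2)[of e ?g] IH s l True by (simp add: ltarget_def)
    next
      case False
      have re': "arrow_rel (etarget e, [(e, False)], esource e) (etarget e, [(e, False)], esource e)"
        by (auto simp: arrow_rel_def lsource_def ltarget_def intro: path_eq.refl)
      have "ginv (generator e) = abs_arrow (etarget e, [(e, False)], esource e)"
        using re by (simp add: generator.abs_eq ginv.abs_eq winv_def linv_def)
      then have "ginv (generator e) \<cdot> ?g = abs_arrow (i, l # w, j)"
        using Cons.prems r re' False l
        by (simp add: gcomp.abs_eq ltarget_def lsource_def)
      then show ?thesis using assms(3)[of e ?g] IH s l False by (simp add: ltarget_def)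
    qed
  qed
  obtain i w j where w: "rep_arrow g = (i, w, j)" by (metis prod_cases3)
  have "arrow_rel (i, w, j) (i, w, j)" using Quotient3_rep_reflp[OF abs, of g] w by simp
  then have "is_path i w j" by (auto simp: arrow_rel_def dest: path_eq_is_path)
  from main[OF this] show ?thesis using Quotient3_abs_rep[OF abs, of g] w by simp
qed

lemma endo_eqI:
  assumes "endomorphism h" "endomorphism h'" "\<And>e. h (generator e) = h' (generator e)"
  shows "h = h'"
proof
  show "h g = h' g" for g
    by (induction g rule: arrow_induct) (simp_all add: endo_ident endo_comp endo_ginv assms)
qed

fun path_val :: "(edge \<Rightarrow> arrow) \<Rightarrow> letter list \<Rightarrow> obj \<Rightarrow> arrow" where
  "path_val f [] j = ident j"
| "path_val f (l # w) j = (if snd l then f (fst l) else ginv (f (fst l))) \<cdot> path_val f w j"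

context
  fixes f :: "edge \<Rightarrow> arrow"
  assumes f: "\<And>e. source (f e) = esource e" "\<And>e. target (f e) = etarget e"
begin

lemma path_val_ends: "is_path i w j \<Longrightarrow> source (path_val f w j) = i \<and> target (path_val f w j) = j"
  by (induction w arbitrary: i) (auto simp: f lsource_def ltarget_def)

lemma path_val_append:
  "is_path i u k \<Longrightarrow> is_path k v j \<Longrightarrow> path_val f (u @ v) j = path_val f u k \<cdot> path_val f v j"
proof (induction u arbitrary: i)
  case Nil
  then show ?case using path_val_ends by auto
next
  case (Cons l u)
  then have "is_path (ltarget l) u k" "lsource l = i" by auto
  then show ?case using Cons path_val_ends[of "ltarget l" u k] path_val_ends[of k v j]
    by (auto simp: f ltarget_def)
qed

lemma path_val_path_eq: "path_eq i j v w \<Longrightarrow> path_val f v j = path_val f w j"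
proof (induction rule: path_eq.induct)
  case (cancel u l v)
  then obtain k where k: "is_path i u k" "is_path k (l # linv l # v) j" "is_path k v j"
    by (auto simp: is_path_append)
  have "path_val f (l # linv l # v) j = path_val f v j"
    using k path_val_ends[of k v j] by (auto simp: f linv_def lsource_def ltarget_def)
  then show ?case using path_val_append[OF k(1,2)] path_val_append[OF k(1,3)] by simp
qed auto

lemma endomorphism_exists: "\<exists>h. endomorphism h \<and> (\<forall>e. h (generator e) = f e)"
proof -
  define h where "h g = (case rep_arrow g of (i, w, j) \<Rightarrow> path_val f w j)" for g
  have abs: "Quotient3 arrow_rel abs_arrow rep_arrow" by (rule Quotient3_arrow)
  have h: "h (abs_arrow (i, w, j)) = path_val f w j" if "is_path i w j" for i w j
  proof -
    have "arrow_rel (i, w, j) (i, w, j)"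
      using that by (auto simp: arrow_rel_def intro: path_eq.refl)
    then have "arrow_rel (rep_arrow (abs_arrow (i, w, j))) (i, w, j)"
      by (metis Quotient3_def abs)
    then show ?thesis by (auto simp: h_def arrow_rel_def intro: path_val_path_eq)
  qed
  have ex: "\<exists>i w j. g = abs_arrow (i, w, j) \<and> is_path i w j" for g
  proof -
    obtain i w j where w: "rep_arrow g = (i, w, j)" by (metis prod_cases3)
    have "arrow_rel (i, w, j) (i, w, j)" using Quotient3_rep_reflp[OF abs, of g] w by simp
    then have "is_path i w j" by (auto simp: arrow_rel_def dest: path_eq_is_path)
    then show ?thesis using Quotient3_abs_rep[OF abs, of g] w by metis
  qed
  have r: "arrow_rel (i, w, j) (i, w, j)" if "is_path i w j" for i w j
    using that by (auto simp: arrow_rel_def intro: path_eq.refl)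
  have 1: "source (h g) = source g \<and> target (h g) = target g" for g
  proof -
    obtain i w j where g: "g = abs_arrow (i, w, j)" "is_path i w j" using ex by blast
    show ?thesis using g h[OF g(2)] path_val_ends[OF g(2)] r[OF g(2)]
      by (simp add: source.abs_eq target.abs_eq)
  qed
  have 2: "h (g \<cdot> g') = h g \<cdot> h g'" if "target g = source g'" for g g'
  proof -
    obtain i w j where g: "g = abs_arrow (i, w, j)" "is_path i w j" using ex by blast
    obtain i' w' j' where g': "g' = abs_arrow (i', w', j')" "is_path i' w' j'" using ex by blast
    have "i' = j" using that g g' r by (simp add: source.abs_eq target.abs_eq)
    then have p: "is_path i (w @ w') j'" using g g' by (auto simp: is_path_append)
    have "g \<cdot> g' = abs_arrow (i, w @ w', j')"
      using g g' r \<open>i' = j\<close> by (simp add: gcomp.abs_eq)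
    then show ?thesis
      using h[OF p] h[OF g(2)] h[OF g'(2)] g g' path_val_append[of i w j w' j'] \<open>i' = j\<close> by simp
  qed
  have 3: "h (generator e) = f e" for e
    using h[of "esource e" "[(e, True)]" "etarget e"]
    by (simp add: generator.abs_eq lsource_def ltarget_def f)
  show ?thesis using 1 2 3 unfolding endomorphism_def by blast
qed

end

lemma bij_of_inverse_endos:
  assumes "endomorphism h" "endomorphism h'"
    and "\<And>e. h (h' (generator e)) = generator e" "\<And>e. h' (h (generator e)) = generator e"
  shows "bij h"
proof -
  have e: "endomorphism (f \<circ> g)" if "endomorphism f" "endomorphism g" for f g
    using that unfolding endomorphism_def by simp
  have i: "endomorphism id" by (simp add: endomorphism_def)
  have "h \<circ> h' = id"
    by (rule endo_eqI[OF e[OF assms(1,2)] i]) (simp add: assms(3))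
  moreover have "h' \<circ> h = id"
    by (rule endo_eqI[OF e[OF assms(2,1)] i]) (simp add: assms(4))
  ultimately show ?thesis using o_bij by blast
qed

lemma forall_obj: "(\<forall>l. P l) \<longleftrightarrow> P S1 \<and> P S2 \<and> P S3"
  by (metis obj.exhaust)

lemma forall_edge: "(\<forall>e. P e) \<longleftrightarrow> (\<forall>l. P (Loop l)) \<and> P E12 \<and> P E23"
  by (metis edge.exhaust)

lemma braid_aut_exists:
  assumes "\<forall>l. f (Loop l) = generator (Loop l)" "\<forall>l. f' (Loop l) = generator (Loop l)"
    and "\<forall>e. source (f e) = esource e \<and> target (f e) = etarget e"
    and "\<forall>e. source (f' e) = esource e \<and> target (f' e) = etarget e"
    and "\<And>h h'. endomorphism h \<Longrightarrow> endomorphism h' \<Longrightarrow> \<forall>e. h (generator e) = f e \<Longrightarrow>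
           \<forall>e. h' (generator e) = f' e \<Longrightarrow>
           h (\<gamma> i j) = \<gamma> i j \<and> h (\<gamma> k j) = \<gamma> k j \<cdot> \<gamma> j i \<cdot> \<gamma> i i \<cdot> \<gamma> i j \<cdot> \<gamma> j j \<and>
           (\<forall>e \<in> {E12, E23}. h (f' e) = generator e \<and> h' (f e) = generator e)"
  shows "\<exists>h. braid_aut i j k h"
proof -
  obtain h where h: "endomorphism h" "\<forall>e. h (generator e) = f e"
    using endomorphism_exists[of f] assms(3) by blast
  obtain h' where h': "endomorphism h'" "\<forall>e. h' (generator e) = f' e"
    using endomorphism_exists[of f'] assms(4) by blast
  note * = assms(5)[OF h(1) h'(1) h(2) h'(2)]
  have "h (h' (generator e)) = generator e \<and> h' (h (generator e)) = generator e" for e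
    using * assms(1,2) h h' by (cases e) auto
  then have "bij h" using bij_of_inverse_endos[OF h(1) h'(1)] by blast
  moreover have "h (\<gamma> l l) = \<gamma> l l" for l using h(2) assms(1) by (cases l) auto
  ultimately show ?thesis using h(1) * unfolding braid_aut_def automorphism_def by blast
qed

lemma braid_aut_unique:
  assumes "braid_aut i j k h" "braid_aut i j k h'"
    and "(i, j, k) \<in> {(S1, S2, S3), (S2, S3, S1), (S3, S1, S2)}"
  shows "h = h'"
proof -
  have e: "endomorphism h" "endomorphism h'"
    using assms unfolding braid_aut_def automorphism_def by auto
  have inv: "h (ginv g) = h' (ginv g)" if "h g = h' g" for g
    using that by (simp add: endo_ginv e)
  have comp: "h (g \<cdot> g') = h' (g \<cdot> g')" if "h g = h' g" "h g' = h' g'" "target g = source g'" for g g'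
    using that by (simp add: endo_comp e)
  have l: "h (generator (Loop l)) = h' (generator (Loop l))" for l
  proof -
    have "h (\<gamma> l l) = h' (\<gamma> l l)" using assms unfolding braid_aut_def by simp
    then show ?thesis by (cases l) auto
  qed
  have ij: "h (\<gamma> i j) = h' (\<gamma> i j)" and kj: "h (\<gamma> k j) = h' (\<gamma> k j)"
    using assms unfolding braid_aut_def by simp_all
  have "h (generator E12) = h' (generator E12) \<and> h (generator E23) = h' (generator E23)"
    using assms(3)
  proof (elim insertE; simp)
    assume "i = S1 \<and> j = S2 \<and> k = S3"
    then show ?thesis using ij inv[OF kj] by simp
  next
    assume "i = S2 \<and> j = S3 \<and> k = S1"
    then show ?thesis using ij comp[OF kj inv[OF ij]] by simp
  next
    assume "i = S3 \<and> j = S1 \<and> k = S2"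
    then show ?thesis using inv[OF kj] comp[OF kj inv[OF ij]] by simp
  qed
  then have "h (generator x) = h' (generator x)" for x using l by (cases x) auto
  then show ?thesis using endo_eqI e by blast
qed

lemma braid_aut_h1: "braid_aut S1 S2 S3 h1"
proof -
  let ?c = "\<gamma> S2 S1 \<cdot> \<gamma> S1 S1 \<cdot> \<gamma> S1 S2 \<cdot> \<gamma> S2 S2"
  let ?f = "\<lambda>e. if e = E23 then ginv ?c \<cdot> \<gamma> S2 S3 else generator e"
  let ?f' = "\<lambda>e. if e = E23 then ?c \<cdot> \<gamma> S2 S3 else generator e"
  have "\<exists>h. braid_aut S1 S2 S3 h"
    by (rule braid_aut_exists[of ?f ?f']) (simp_all add: endo_comp endo_ginv)
  then show ?thesis unfolding h1_def
    by (metis (mono_tags, lifting) braid_aut_unique insertI1 theI')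
qed

lemma braid_aut_h2: "braid_aut S2 S3 S1 h2"
proof -
  let ?c = "\<gamma> S3 S2 \<cdot> \<gamma> S2 S2 \<cdot> \<gamma> S2 S3 \<cdot> \<gamma> S3 S3"
  let ?f = "\<lambda>e. if e = E12 then \<gamma> S1 S2 \<cdot> \<gamma> S2 S3 \<cdot> ?c \<cdot> \<gamma> S3 S2 else generator e"
  let ?f' = "\<lambda>e. if e = E12 then \<gamma> S1 S2 \<cdot> \<gamma> S2 S3 \<cdot> ginv ?c \<cdot> \<gamma> S3 S2 else generator e"
  have "\<exists>h. braid_aut S2 S3 S1 h"
    by (rule braid_aut_exists[of ?f ?f']) (simp_all add: endo_comp endo_ginv)
  then show ?thesis unfolding h2_def
    by (metis (mono_tags, lifting) braid_aut_unique insertI1 insertI2 theI')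
qed

lemma braid_aut_h3: "braid_aut S3 S1 S2 h3"
proof -
  let ?c = "\<gamma> S1 S3 \<cdot> \<gamma> S3 S3 \<cdot> \<gamma> S3 S1 \<cdot> \<gamma> S1 S1"
  let ?f = "\<lambda>e. if e = E12 then ginv ?c \<cdot> \<gamma> S1 S2
                else if e = E23 then \<gamma> S2 S1 \<cdot> ?c \<cdot> \<gamma> S1 S3 else generator e"
  let ?f' = "\<lambda>e. if e = E12 then ?c \<cdot> \<gamma> S1 S2
                else if e = E23 then \<gamma> S2 S1 \<cdot> ginv ?c \<cdot> \<gamma> S1 S3 else generator e"
  have "\<exists>h. braid_aut S3 S1 S2 h"
    by (rule braid_aut_exists[of ?f ?f']) (simp_all add: endo_comp endo_ginv)
  then show ?thesis unfolding h3_def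
    by (metis (mono_tags, lifting) braid_aut_unique insertI1 insertI2 theI')
qed


section \<open>Representations and their trace coordinates\<close>

definition SL2 :: "(complex^2^2) set" where
  "SL2 = {A. det A = 1}"

definition reps :: "(arrow \<Rightarrow> complex^2^2) set" where
  "reps = {\<rho>. (\<forall>g. \<rho> g \<in> SL2) \<and>
               (\<forall>g g'. target g = source g' \<longrightarrow> \<rho> (g \<cdot> g') = \<rho> g ** \<rho> g')}"

definition rep_equiv :: "((arrow \<Rightarrow> complex^2^2) \<times> (arrow \<Rightarrow> complex^2^2)) set" where
  "rep_equiv = {(\<rho>, \<rho>'). \<rho> \<in> reps \<and> \<rho>' \<in> reps \<and>
     (\<exists>N. (\<forall>i. N i \<in> SL2) \<and>
          (\<forall>g. \<rho>' g = N (source g) ** \<rho> g ** matrix_inv (N (target g))))}"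

definition rep_classes :: "(arrow \<Rightarrow> complex^2^2) set set" where
  "rep_classes = reps // rep_equiv"

text \<open>The induced map \<open>[\<rho>] \<mapsto> [\<rho> \<circ> h]\<close> on equivalence classes.\<close>

definition pushforward ::
  "(arrow \<Rightarrow> arrow) \<Rightarrow> (arrow \<Rightarrow> complex^2^2) set \<Rightarrow> (arrow \<Rightarrow> complex^2^2) set" where
  "pushforward h C = (\<Union>\<rho>\<in>C. rep_equiv `` {\<rho> \<circ> h})"

definition normalized :: "(arrow \<Rightarrow> complex^2^2) \<Rightarrow> bool" where
  "normalized \<rho> \<longleftrightarrow> \<rho> (\<gamma> S1 S2) = mat 1 \<and> \<rho> (\<gamma> S2 S3) = mat 1"

text \<open>The choice is immaterial for the trace coordinates; see \<open>trace_coords_normalized\<close> below.\<close>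

definition normal_rep :: "(arrow \<Rightarrow> complex^2^2) set \<Rightarrow> (arrow \<Rightarrow> complex^2^2)" where
  "normal_rep C = (SOME \<rho>. \<rho> \<in> C \<and> normalized \<rho>)"

definition tr_a :: "(arrow \<Rightarrow> complex^2^2) set \<Rightarrow> obj \<Rightarrow> complex" where
  "tr_a C i = trace (normal_rep C (\<gamma> i i))"

definition tr_a4 :: "(arrow \<Rightarrow> complex^2^2) set \<Rightarrow> complex" where
  "tr_a4 C = trace (normal_rep C (\<gamma> S1 S1) ** normal_rep C (\<gamma> S2 S2) ** normal_rep C (\<gamma> S3 S3))"

definition tr_x :: "(arrow \<Rightarrow> complex^2^2) set \<Rightarrow> obj \<Rightarrow> obj \<Rightarrow> complex" where
  "tr_x C i j = trace (normal_rep C (\<gamma> i i) ** normal_rep C (\<gamma> j j))"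

subsection \<open>Well-definedness\<close>

lemma SL2_mat1: "mat 1 \<in> SL2"
  and SL2_mult: "A \<in> SL2 \<Longrightarrow> B \<in> SL2 \<Longrightarrow> A ** B \<in> SL2"
  by (auto simp: SL2_def det_mul)

lemma SL2_inv:
  assumes "A \<in> SL2"
  shows "A ** matrix_inv A = mat 1" "matrix_inv A ** A = mat 1" "matrix_inv A \<in> SL2"
proof -
  have "invertible A" using assms by (simp add: SL2_def invertible_det_nz)
  then show *: "A ** matrix_inv A = mat 1" "matrix_inv A ** A = mat 1"
    unfolding invertible_def matrix_inv_def by (metis (mono_tags, lifting) someI_ex)+
  from arg_cong[OF this(1), of det] show "matrix_inv A \<in> SL2"
    using assms by (simp add: SL2_def det_mul)
qed

lemma SL2_inv_cancel:
  assumes "A \<in> SL2"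
  shows "A ** (matrix_inv A ** B) = B" "matrix_inv A ** (A ** B) = B"
  using SL2_inv[OF assms] by (simp_all add: matrix_mul_assoc)

lemma conj_in_reps:
  assumes "\<rho> \<in> reps" "\<forall>i. N i \<in> SL2"
  shows "(\<lambda>g. N (source g) ** \<rho> g ** matrix_inv (N (target g))) \<in> reps"
  using assms unfolding reps_def
  by (auto intro!: SL2_mult SL2_inv simp: matrix_mul_assoc[symmetric] SL2_inv_cancel)

lemma equiv_rep_equiv: "equiv reps rep_equiv"
proof (rule equivI)
  have mi: "matrix_inv (mat 1 :: complex^2^2) = mat 1"
    using SL2_inv(1)[OF SL2_mat1] by simp
  show "rep_equiv \<subseteq> reps \<times> reps" by (auto simp: rep_equiv_def)
  show "refl_on reps rep_equiv"
  proof (rule refl_onI)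
    fix \<rho> assume "\<rho> \<in> reps"
    then show "(\<rho>, \<rho>) \<in> rep_equiv"
      unfolding rep_equiv_def by (auto intro!: exI[of _ "\<lambda>_. mat 1"] simp: SL2_mat1 mi)
  qed
  show "sym rep_equiv"
  proof (rule symI)
    fix \<rho> \<rho>' assume "(\<rho>, \<rho>') \<in> rep_equiv"
    then obtain N where N: "\<rho> \<in> reps" "\<rho>' \<in> reps" "\<forall>i. N i \<in> SL2"
      "\<forall>g. \<rho>' g = N (source g) ** \<rho> g ** matrix_inv (N (target g))"
      unfolding rep_equiv_def by auto
    have inv2: "matrix_inv (matrix_inv A) = A" if "A \<in> SL2" for A
    proof -
      have "matrix_inv A ** matrix_inv (matrix_inv A) = mat 1"
        using SL2_inv[OF SL2_inv(3)[OF that]] by simp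
      then have "A ** (matrix_inv A ** matrix_inv (matrix_inv A)) = A" by simp
      then show ?thesis using SL2_inv_cancel(1)[OF that] by metis
    qed
    show "(\<rho>', \<rho>) \<in> rep_equiv"
      unfolding rep_equiv_def using N
      by (auto intro!: exI[of _ "\<lambda>i. matrix_inv (N i)"] SL2_inv
          simp: inv2 matrix_mul_assoc[symmetric] SL2_inv_cancel SL2_inv)
  qed
  show "trans rep_equiv"
  proof (rule transI)
    fix \<rho> \<rho>' \<rho>'' assume "(\<rho>, \<rho>') \<in> rep_equiv" "(\<rho>', \<rho>'') \<in> rep_equiv"
    then obtain N N' where N: "\<rho> \<in> reps" "\<rho>'' \<in> reps" "\<forall>i. N i \<in> SL2" "\<forall>i. N' i \<in> SL2"
      "\<forall>g. \<rho>' g = N (source g) ** \<rho> g ** matrix_inv (N (target g))"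
      "\<forall>g. \<rho>'' g = N' (source g) ** \<rho>' g ** matrix_inv (N' (target g))"
      unfolding rep_equiv_def by auto
    have "matrix_inv (A ** B) = matrix_inv B ** matrix_inv A" if "A \<in> SL2" "B \<in> SL2" for A B
    proof -
      have "(A ** B) ** (matrix_inv B ** matrix_inv A) = mat 1"
        using that by (simp add: matrix_mul_assoc[symmetric] SL2_inv_cancel SL2_inv)
      then have "matrix_inv (A ** B) ** ((A ** B) ** (matrix_inv B ** matrix_inv A)) =
          matrix_inv (A ** B)" by simp
      then show ?thesis using SL2_inv_cancel(2)[OF SL2_mult[OF that]] by metis
    qed
    then show "(\<rho>, \<rho>'') \<in> rep_equiv"
      unfolding rep_equiv_def using N
      by (auto intro!: exI[of _ "\<lambda>i. N' i ** N i"] SL2_mult simp: matrix_mul_assoc)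
  qed
qed

lemma reps_compose: "endomorphism h \<Longrightarrow> \<rho> \<in> reps \<Longrightarrow> \<rho> \<circ> h \<in> reps"
  by (auto simp: reps_def endo_comp)

lemma pushforward_class:
  assumes "endomorphism h" "\<rho> \<in> reps"
  shows "pushforward h (rep_equiv `` {\<rho>}) = rep_equiv `` {\<rho> \<circ> h}"
proof -
  have "(\<rho> \<circ> h, \<rho>' \<circ> h) \<in> rep_equiv" if eq: "(\<rho>, \<rho>') \<in> rep_equiv" for \<rho> \<rho>'
  proof -
    obtain N where N: "\<rho> \<in> reps" "\<rho>' \<in> reps" "\<forall>i. N i \<in> SL2"
      "\<forall>g. \<rho>' g = N (source g) ** \<rho> g ** matrix_inv (N (target g))"
      using eq unfolding rep_equiv_def by auto
    have "\<forall>g. (\<rho>' \<circ> h) g = N (source g) ** (\<rho> \<circ> h) g ** matrix_inv (N (target g))"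
      using N(4) assms(1) by simp
    then show ?thesis
      unfolding rep_equiv_def using N(3) reps_compose[OF assms(1)] N(1,2) by blast
  qed
  then have "(\<lambda>\<rho>. rep_equiv `` {\<rho> \<circ> h}) respects rep_equiv"
    by (intro congruentI equiv_class_eq[OF equiv_rep_equiv])
  from UN_equiv_class[OF equiv_rep_equiv this assms(2)]
  show ?thesis by (simp add: pushforward_def)
qed

lemma normalized_exists:
  assumes "C \<in> rep_classes"
  shows "\<exists>\<rho>. \<rho> \<in> C \<and> normalized \<rho>"
proof -
  obtain \<rho> where \<rho>: "\<rho> \<in> reps" "C = rep_equiv `` {\<rho>}"
    using assms unfolding rep_classes_def by (auto elim: quotientE)
  define N where "N = case_obj (mat 1) (\<rho> (\<gamma> S1 S2)) (\<rho> (\<gamma> S1 S2) ** \<rho> (\<gamma> S2 S3))"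
  define \<rho>' where "\<rho>' = (\<lambda>g. N (source g) ** \<rho> g ** matrix_inv (N (target g)))"
  have N: "\<forall>i. N i \<in> SL2"
    using \<rho>(1) unfolding forall_obj N_def reps_def by (auto intro: SL2_mult SL2_mat1)
  have "\<rho>' \<in> reps" unfolding \<rho>'_def using conj_in_reps[OF \<rho>(1) N] .
  then have "\<rho>' \<in> C" using \<rho> N by (auto simp: rep_equiv_def \<rho>'_def)
  moreover have "normalized \<rho>'"
    using SL2_inv(1)[OF N[rule_format, of S2]] SL2_inv(1)[OF N[rule_format, of S3]]
    by (simp add: normalized_def \<rho>'_def del: \<gamma>.simps) (simp add: N_def)
  ultimately show ?thesis by blast
qed

lemma trace_coords_normalized:
  assumes "C \<in> rep_classes" "\<rho> \<in> C" "normalized \<rho>"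
  shows "tr_a C i = trace (\<rho> (\<gamma> i i))"
    and "tr_a4 C = trace (\<rho> (\<gamma> S1 S1) ** \<rho> (\<gamma> S2 S2) ** \<rho> (\<gamma> S3 S3))"
    and "tr_x C i j = trace (\<rho> (\<gamma> i i) ** \<rho> (\<gamma> j j))"
proof -
  let ?n = "normal_rep C"
  have n: "?n \<in> C" "normalized ?n"
    using someI_ex[OF normalized_exists[OF assms(1)]] by (auto simp: normal_rep_def)
  obtain N where N: "\<forall>i. N i \<in> SL2"
    "\<forall>g. ?n g = N (source g) ** \<rho> g ** matrix_inv (N (target g))"
    using quotient_eq_iff[OF equiv_rep_equiv assms(1)[unfolded rep_classes_def]
        assms(1)[unfolded rep_classes_def] assms(2) n(1)]
    unfolding rep_equiv_def by auto
  have eq: "A = B" if "A ** matrix_inv B = mat 1" "B \<in> SL2" for A B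
  proof -
    have "A ** matrix_inv B ** B = B" using that(1) by simp
    then show ?thesis using SL2_inv(2)[OF that(2)] by (simp add: matrix_mul_assoc[symmetric])
  qed
  have "N S1 = N S2" "N S2 = N S3"
    using N(2)[rule_format, of "\<gamma> S1 S2"] N(2)[rule_format, of "\<gamma> S2 S3"] n(2) assms(3) N(1)
    by (auto simp: normalized_def intro!: eq)
  then have const: "N i = N S1" for i by (cases i) auto
  have c: "?n (\<gamma> i i) = N S1 ** \<rho> (\<gamma> i i) ** matrix_inv (N S1)" for i
    using N(2)[rule_format, of "\<gamma> i i"] unfolding source_gamma target_gamma const[of i] .
  have t: "trace (N S1 ** (A ** matrix_inv (N S1))) = trace A" for A
    using trace_mul_sym[of "N S1" "A ** matrix_inv (N S1)"] SL2_inv(2) N(1)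
    by (simp add: matrix_mul_assoc[symmetric])
  have t': "trace (N S1 ** (A ** (B ** matrix_inv (N S1)))) = trace (A ** B)" for A B
    using t[of "A ** B"] by (simp add: matrix_mul_assoc)
  have t'': "trace (N S1 ** (A ** (B ** (D ** matrix_inv (N S1))))) = trace (A ** (B ** D))" for A B D
    using t[of "A ** (B ** D)"] by (simp add: matrix_mul_assoc)
  note s = c matrix_mul_assoc[symmetric] SL2_inv_cancel[OF N(1)[rule_format]] t t' t''
  show "tr_a C i = trace (\<rho> (\<gamma> i i))" unfolding tr_a_def by (simp only: s)
  show "tr_a4 C = trace (\<rho> (\<gamma> S1 S1) ** \<rho> (\<gamma> S2 S2) ** \<rho> (\<gamma> S3 S3))"
    unfolding tr_a4_def by (simp only: s)
  show "tr_x C i j = trace (\<rho> (\<gamma> i i) ** \<rho> (\<gamma> j j))" unfolding tr_x_def by (simp only: s)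
qed

end

theory Submission
  imports Defs
begin

text \<open>
  The coordinate \<open>x\<^sub>i\<^sub>j\<close> of a class is the trace of the loop
  \<open>\<gamma>\<^sub>i\<^sub>i\<gamma>\<^sub>i\<^sub>j\<gamma>\<^sub>j\<^sub>j\<gamma>\<^sub>j\<^sub>i\<close> under \<^emph>\<open>any\<close> member of the class (lemma \<open>tr_x_eq_trace_loop\<close>): the two
  connecting arrows become the identity in a normalized member, and the trace of a loop does not
  see the change of member.  So, for \<open>h\<close> one of \<open>h\<^sub>1\<close>, \<open>h\<^sub>2\<close>, \<open>h\<^sub>3\<close>,
  \<open>\<rho> \<circ> h\<close> need not be normalized; it is enough to evaluate a
  normalized \<open>\<rho>\<close> on the images of these loops under \<open>h\<close>.  If \<open>A\<close>, \<open>B\<close>, \<open>D\<close> are the matrices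
  of the loops at \<open>i\<close>, \<open>j\<close>, \<open>k\<close>, with \<open>(i, j, k)\<close> a cyclic permutation of \<open>(1, 2, 3)\<close>, then \<open>h\<close>
  keeps \<open>A\<close> and \<open>B\<close> and conjugates \<open>D\<close> by \<open>P = AB\<close>.  Hence, up to cyclic rotation,
  \<open>x'\<^sub>i\<^sub>j = tr(AB)\<close>, \<open>x'\<^sub>j\<^sub>k = tr(DABA\<^sup>-\<^sup>1)\<close> and \<open>x'\<^sub>i\<^sub>k = tr(DPAP\<^sup>-\<^sup>1)\<close>.

  The last two are instances of a single formula for \<open>tr(ZXYX\<^sup>-\<^sup>1)\<close> (lemma \<open>trace_conj_SL2\<close>),
  which follows from \<open>tr(XY) + tr(XY\<^sup>-\<^sup>1) = tr(X)tr(Y)\<close> (lemma \<open>trace_mult_inv_SL2\<close>).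
  Since \<open>a\<^sub>4 = tr(ABD)\<close> is invariant under cyclic rotation, the three automorphisms are treated
  at once (lemma \<open>braid_aut_trace_coords\<close>).
\<close>

section \<open>Trace identities in the special linear group\<close>

text \<open>This is the Cayley--Hamilton theorem \<open>Y + Y\<^sup>-\<^sup>1 = tr(Y) I\<close>, multiplied by \<open>X\<close> before taking
  traces; the inverse of \<open>Y\<close> is its adjugate.\<close>

lemma trace_mult_inv_SL2:
  assumes "Y \<in> SL2"
  shows "trace (X ** matrix_inv Y) = trace X * trace Y - trace (X ** Y)"
proof -
  define Z :: "complex^2^2" where "Z = mat (trace Y) - Y"
  have d: "Y$1$1 * Y$2$2 - Y$1$2 * Y$2$1 = 1"
    using assms by (simp add: SL2_def det_2)
  have "Y ** Z = mat 1"
    using d by (simp add: Z_def vec_eq_iff forall_2 matrix_matrix_mult_def sum_2 mat_def trace_def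
        algebra_simps)
  then have inv: "matrix_inv Y = Z"
    using SL2_inv_cancel(2)[OF assms, of Z] by simp
  show ?thesis
    unfolding inv
    by (simp add: Z_def matrix_matrix_mult_def sum_2 mat_def trace_def algebra_simps)
qed

lemma matrix_inv_mult_SL2:
  assumes "A \<in> SL2" "B \<in> SL2"
  shows "matrix_inv (A ** B) = matrix_inv B ** matrix_inv A"
proof -
  have "(A ** B) ** (matrix_inv B ** matrix_inv A) = mat 1"
    using assms by (simp add: matrix_mul_assoc[symmetric] SL2_inv_cancel SL2_inv)
  then show ?thesis
    using SL2_inv_cancel(2)[OF SL2_mult[OF assms], of "matrix_inv B ** matrix_inv A"] by simp
qed

text \<open>A repeated letter is removed by splitting the word after each of its occurrences: in
  \<open>tr(ZX \<cdot> YX)\<close> the product of the first half with the inverse of the second is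
  \<open>ZX X\<^sup>-\<^sup>1Y\<^sup>-\<^sup>1 = ZY\<^sup>-\<^sup>1\<close>.\<close>

lemma trace_repeated_SL2:
  assumes "X \<in> SL2" "Y \<in> SL2"
  shows "trace (Z ** X ** Y ** X)
    = trace (Z ** X) * trace (Y ** X) - trace Z * trace Y + trace (Z ** Y)"
proof -
  have "Z ** X ** matrix_inv (Y ** X) = Z ** matrix_inv Y"
    using assms by (simp add: matrix_inv_mult_SL2 matrix_mul_assoc[symmetric] SL2_inv_cancel)
  then have "trace (Z ** matrix_inv Y)
      = trace (Z ** X) * trace (Y ** X) - trace (Z ** X ** Y ** X)"
    using trace_mult_inv_SL2[OF SL2_mult[OF assms(2,1)], of "Z ** X"]
    by (simp add: matrix_mul_assoc)
  then show ?thesis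
    by (simp add: trace_mult_inv_SL2[OF assms(2)] algebra_simps)
qed

text \<open>Replacing \<open>X\<^sup>-\<^sup>1\<close> by \<open>tr(X) I - X\<close> leaves a word in which \<open>X\<close> occurs twice.\<close>

lemma trace_conj_SL2:
  assumes "X \<in> SL2" "Y \<in> SL2"
  shows "trace (Z ** X ** Y ** matrix_inv X)
    = trace (Z ** X ** Y) * trace X - trace (Z ** X) * trace (Y ** X)
      + trace Z * trace Y - trace (Z ** Y)"
  by (simp add: trace_mult_inv_SL2[OF assms(1)] trace_repeated_SL2[OF assms])

text \<open>The action of a braid generator on a triple of matrices replaces \<open>D\<close> by its conjugate \<open>D'\<close>.
  In \<open>tr(BD')\<close> the factor \<open>B\<close> cancels, and what remains is a conjugation by \<open>A\<close> alone.
  Nothing cancels in \<open>tr(AD')\<close>; there \<open>AB\<close> plays the part of a single letter \<open>X\<close> in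
  \<open>trace_conj_SL2\<close>, and the resulting words \<open>ABA\<close> and \<open>DABA\<close> are reduced once more
  because \<open>A\<close> is repeated in them.\<close>

lemma trace_braid_SL2:
  fixes A B D :: "complex^2^2"
  assumes A: "A \<in> SL2" and B: "B \<in> SL2"
  defines "D' \<equiv> matrix_inv (A ** B) ** D ** (A ** B)"
  defines "s \<equiv> trace A * trace (A ** B ** D) + trace B * trace D"
  shows "trace (B ** D') = - trace (A ** B) * trace (A ** D) - trace (B ** D) + s"
    and "trace (A ** D') = (trace (A ** B))\<^sup>2 * trace (A ** D) + trace (A ** B) * trace (B ** D)
      - trace (A ** D) - trace (A ** B) * s
      + (trace A * trace D + trace B * trace (A ** B ** D))"
proof -
  let ?P = "A ** B"
  have P: "?P \<in> SL2" by (rule SL2_mult[OF A B])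
  have DAB: "trace (D ** A ** B) = trace (A ** B ** D)"
    using trace_mul_sym[of D ?P] by (simp add: matrix_mul_assoc)
  have "B ** D' = matrix_inv A ** (D ** A ** B)"
    unfolding D'_def using A B
    by (simp add: matrix_inv_mult_SL2 matrix_mul_assoc[symmetric] SL2_inv_cancel)
  then have "trace (B ** D') = trace (D ** A ** B ** matrix_inv A)"
    using trace_mul_sym by metis
  then show "trace (B ** D') = - trace ?P * trace (A ** D) - trace (B ** D) + s"
    by (simp add: trace_conj_SL2[OF A B] DAB trace_mul_sym[of D A] trace_mul_sym[of B A]
        trace_mul_sym[of D B] s_def algebra_simps)
  have "trace (A ** D') = trace ((A ** matrix_inv ?P) ** (D ** ?P))"
    by (simp add: D'_def matrix_mul_assoc)
  also have "\<dots> = trace (D ** ?P ** A ** matrix_inv ?P)"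
    using trace_mul_sym[of "A ** matrix_inv ?P" "D ** ?P"] by (simp add: matrix_mul_assoc)
  finally have conj: "trace (A ** D') = trace (D ** ?P ** A ** matrix_inv ?P)" .
  have "trace (A ** ?P) = trace (mat 1 ** A ** B ** A)"
    using trace_mul_sym[of A ?P] by simp
  then have AAB: "trace (A ** ?P) = trace A * trace ?P - trace B"
    unfolding trace_repeated_SL2[OF A B] by (simp add: trace_mul_sym[of B A] trace_I)
  have DPA: "trace (D ** ?P ** A) = trace (A ** D) * trace ?P - trace D * trace B + trace (B ** D)"
    using trace_repeated_SL2[OF A B, of D]
    by (simp add: matrix_mul_assoc trace_mul_sym[of D A] trace_mul_sym[of B A] trace_mul_sym[of D B])
  show "trace (A ** D') = (trace ?P)\<^sup>2 * trace (A ** D) + trace ?P * trace (B ** D)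
      - trace (A ** D) - trace ?P * s + (trace A * trace D + trace B * trace (A ** B ** D))"
    unfolding conj trace_conj_SL2[OF P A] DPA
    by (simp add: AAB trace_mul_sym[of D ?P] trace_mul_sym[of D A] s_def power2_eq_square
        algebra_simps)
qed

section \<open>Trace coordinates as traces of loops\<close>

lemma reps_gcomp: "\<rho> \<in> reps \<Longrightarrow> target g = source g' \<Longrightarrow> \<rho> (g \<cdot> g') = \<rho> g ** \<rho> g'"
  and reps_SL2: "\<rho> \<in> reps \<Longrightarrow> \<rho> g \<in> SL2"
  by (auto simp: reps_def)

lemma reps_ident:
  assumes "\<rho> \<in> reps"
  shows "\<rho> (ident i) = mat 1"
proof -
  have "\<rho> (ident i) = \<rho> (ident i) ** \<rho> (ident i)"
    using reps_gcomp[OF assms, of "ident i" "ident i"] by simp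
  then show ?thesis
    using SL2_inv(2) SL2_inv_cancel(2) reps_SL2[OF assms] by metis
qed

lemma reps_ginv:
  assumes "\<rho> \<in> reps"
  shows "\<rho> (ginv g) = matrix_inv (\<rho> g)"
proof -
  have "\<rho> g ** \<rho> (ginv g) = mat 1"
    using reps_gcomp[OF assms, of g "ginv g"] reps_ident[OF assms] by simp
  then show ?thesis
    using SL2_inv_cancel(2)[OF reps_SL2[OF assms], of g "\<rho> (ginv g)"] by simp
qed

lemma gamma_swap: "i \<noteq> j \<Longrightarrow> \<gamma> j i = ginv (\<gamma> i j)"
  by (cases i; cases j; simp)

lemma gamma_triangle: "distinct [i, j, k] \<Longrightarrow> \<gamma> i j \<cdot> \<gamma> j k = \<gamma> i k"
  by (cases i; cases j; cases k; simp)

lemma normalized_gamma: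
  assumes "\<rho> \<in> reps" "normalized \<rho>" "i \<noteq> j"
  shows "\<rho> (\<gamma> i j) = mat 1"
proof -
  have inv1: "matrix_inv (mat 1 :: complex^2^2) = mat 1"
    using SL2_inv(1)[OF SL2_mat1] by simp
  have swap: "\<rho> (\<gamma> l k) = mat 1" if "\<rho> (\<gamma> k l) = mat 1" "k \<noteq> l" for k l
    unfolding gamma_swap[OF that(2)] reps_ginv[OF assms(1)] that(1) by (rule inv1)
  have 12: "\<rho> (\<gamma> S1 S2) = mat 1" and 23: "\<rho> (\<gamma> S2 S3) = mat 1"
    using assms(2) by (simp_all add: normalized_def)
  have "\<rho> (\<gamma> S1 S2 \<cdot> \<gamma> S2 S3) = mat 1"
    using reps_gcomp[OF assms(1), of "\<gamma> S1 S2" "\<gamma> S2 S3"] 12 23 by (simp del: \<gamma>.simps)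
  then have 13: "\<rho> (\<gamma> S1 S3) = mat 1"
    by simp
  show ?thesis
    using assms(3) 12 23 13 swap[OF 12] swap[OF 23] swap[OF 13]
    by (cases i; cases j) (simp_all del: \<gamma>.simps)
qed

lemma trace_loop_equiv:
  assumes "(\<rho>, \<rho>') \<in> rep_equiv" "source g = target g"
  shows "trace (\<rho>' g) = trace (\<rho> g)"
proof -
  obtain N where N: "\<forall>i. N i \<in> SL2"
    "\<forall>g. \<rho>' g = N (source g) ** \<rho> g ** matrix_inv (N (target g))"
    using assms(1) unfolding rep_equiv_def by auto
  let ?N = "N (target g)"
  have "trace (\<rho>' g) = trace (?N ** (\<rho> g ** matrix_inv ?N))"
    using N(2) assms(2) by (simp add: matrix_mul_assoc)
  also have "\<dots> = trace (\<rho> g ** (matrix_inv ?N ** ?N))"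
    using trace_mul_sym[of ?N "\<rho> g ** matrix_inv ?N"] by (simp add: matrix_mul_assoc)
  also have "\<dots> = trace (\<rho> g)"
    using SL2_inv(2)[OF N(1)[rule_format]] by simp
  finally show ?thesis .
qed

text \<open>This expresses the coordinate without a normalization, so that it can be evaluated at the
  member \<open>\<rho> \<circ> h\<close> of the image class.\<close>

lemma tr_x_eq_trace_loop:
  assumes "C \<in> rep_classes" "\<rho> \<in> C" "i \<noteq> j"
  shows "tr_x C i j = trace (\<rho> (\<gamma> i i \<cdot> \<gamma> i j \<cdot> \<gamma> j j \<cdot> \<gamma> j i))"
proof -
  obtain n where n: "n \<in> C" "normalized n"
    using normalized_exists[OF assms(1)] by blast
  have eq: "(n, \<rho>) \<in> rep_equiv"
    using quotient_eq_iff[OF equiv_rep_equiv assms(1)[unfolded rep_classes_def]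
        assms(1)[unfolded rep_classes_def] n(1) assms(2)] by simp
  then have r: "n \<in> reps" by (simp add: rep_equiv_def)
  have "tr_x C i j = trace (n (\<gamma> i i) ** n (\<gamma> j j))"
    by (rule trace_coords_normalized(3)[OF assms(1) n])
  also have "\<dots> = trace (n (\<gamma> i i \<cdot> \<gamma> i j \<cdot> \<gamma> j j \<cdot> \<gamma> j i))"
    using normalized_gamma[OF r n(2)] assms(3) by (simp add: reps_gcomp[OF r] del: \<gamma>.simps)
  also have "\<dots> = trace (\<rho> (\<gamma> i i \<cdot> \<gamma> i j \<cdot> \<gamma> j j \<cdot> \<gamma> j i))"
    by (rule trace_loop_equiv[OF eq, symmetric]) (simp del: \<gamma>.simps)
  finally show ?thesis .
qed

lemma tr_x_pushforward:
  assumes "C \<in> rep_classes" "\<rho> \<in> C" "endomorphism h" "i \<noteq> j"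
  shows "tr_x (pushforward h C) i j = trace (\<rho> (h (\<gamma> i i \<cdot> \<gamma> i j \<cdot> \<gamma> j j \<cdot> \<gamma> j i)))"
proof -
  obtain \<sigma> where \<sigma>: "\<sigma> \<in> reps" "C = rep_equiv `` {\<sigma>}"
    using assms(1) unfolding rep_classes_def by (auto elim: quotientE)
  have \<rho>: "\<rho> \<in> reps" and C: "C = rep_equiv `` {\<rho>}"
    using assms(2) \<sigma> equiv_class_eq[OF equiv_rep_equiv] by (auto simp: rep_equiv_def)
  have rh: "\<rho> \<circ> h \<in> reps" by (rule reps_compose[OF assms(3) \<rho>])
  have push: "pushforward h C = rep_equiv `` {\<rho> \<circ> h}"
    unfolding C by (rule pushforward_class[OF assms(3) \<rho>])
  have "pushforward h C \<in> rep_classes"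
    unfolding push rep_classes_def by (rule quotientI[OF rh])
  moreover have "\<rho> \<circ> h \<in> pushforward h C"
    unfolding push by (rule equiv_class_self[OF equiv_rep_equiv rh])
  ultimately show ?thesis
    using tr_x_eq_trace_loop[of "pushforward h C" "\<rho> \<circ> h" i j] assms(4) by simp
qed

section \<open>The action of a braid generator\<close>

text \<open>Let \<open>w\<close> be the image of \<open>\<gamma>\<^sub>k\<^sub>j\<close>.  A normalized representation sends \<open>w\<close> to \<open>AB\<close>.
  The loops of \<open>x\<^sub>j\<^sub>k\<close> and \<open>x\<^sub>i\<^sub>k\<close> reach \<open>k\<close> along \<open>\<gamma>\<^sub>j\<^sub>k\<close> and return along \<open>\<gamma>\<^sub>k\<^sub>j\<close>, up to
  the arrows between \<open>i\<close> and \<open>j\<close>, which \<open>h\<close> fixes.  So their images contain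
  \<open>w\<^sup>-\<^sup>1\<gamma>\<^sub>k\<^sub>kw\<close>, and the traces are those of \<open>trace_braid_SL2\<close>.\<close>

lemma braid_aut_trace_coords:
  assumes C: "C \<in> rep_classes" and h: "braid_aut i j k h"
    and ijk: "(i, j, k) \<in> {(S1, S2, S3), (S2, S3, S1), (S3, S1, S2)}"
  defines "s \<equiv> tr_a C i * tr_a4 C + tr_a C j * tr_a C k"
  defines "x \<equiv> tr_x C" and "x' \<equiv> tr_x (pushforward h C)"
  shows "x' i j = x i j"
    and "x' j k = - x i j * x i k - x j k + s"
    and "x' i k = (x i j)\<^sup>2 * x i k + x i j * x j k - x i k - x i j * s
      + (tr_a C i * tr_a C k + tr_a C j * tr_a4 C)"
proof -
  have dist: "i \<noteq> j" "j \<noteq> k" "i \<noteq> k" "j \<noteq> i" "k \<noteq> j" "k \<noteq> i" using ijk by auto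
  obtain \<rho> where \<rho>: "\<rho> \<in> C" "normalized \<rho>"
    using normalized_exists[OF C] by blast
  have r: "\<rho> \<in> reps"
    using C \<rho>(1) unfolding rep_classes_def by (auto elim!: quotientE simp: rep_equiv_def)
  note coords = trace_coords_normalized[OF C \<rho>]
  define A where "A = \<rho> (\<gamma> i i)"
  define B where "B = \<rho> (\<gamma> j j)"
  define D where "D = \<rho> (\<gamma> k k)"
  have A: "A \<in> SL2" and B: "B \<in> SL2"
    unfolding A_def B_def by (rule reps_SL2[OF r])+
  (* a cyclic permutation of the indices rotates the product defining a4 *)
  have a4: "tr_a4 C = trace (A ** B ** D)"
    using ijk unfolding coords(2) A_def B_def D_def
    by (elim insertE) (simp_all del: \<gamma>.simps, (metis trace_mul_sym matrix_mul_assoc)+)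
  have s: "s = trace A * trace (A ** B ** D) + trace B * trace D"
    by (simp only: s_def a4 coords(1) A_def B_def D_def)

  define w where "w = \<gamma> k j \<cdot> \<gamma> j i \<cdot> \<gamma> i i \<cdot> \<gamma> i j \<cdot> \<gamma> j j"
  have w_ends: "source w = k" "target w = j"
    by (simp_all add: w_def del: \<gamma>.simps)
  have \<rho>w: "\<rho> w = A ** B"
    using normalized_gamma[OF r \<rho>(2)] dist
    by (simp add: w_def A_def B_def reps_gcomp[OF r] del: \<gamma>.simps)
  have e: "endomorphism h" and hloop: "h (\<gamma> l l) = \<gamma> l l" and hij: "h (\<gamma> i j) = \<gamma> i j"
    and hkj: "h (\<gamma> k j) = w" for l
    using h by (simp_all add: braid_aut_def automorphism_def w_def)
  have hji: "h (\<gamma> j i) = \<gamma> j i"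
    using gamma_swap[OF dist(1)] endo_ginv[OF e] hij by metis
  have hjk: "h (\<gamma> j k) = ginv w"
    using gamma_swap[OF dist(5)] endo_ginv[OF e] hkj by metis
  have hik: "h (\<gamma> i k) = \<gamma> i j \<cdot> ginv w"
    using gamma_triangle[of i j k] endo_comp[OF e, of "\<gamma> i j" "\<gamma> j k"] hij hjk dist by simp
  have hki: "h (\<gamma> k i) = w \<cdot> \<gamma> j i"
    using gamma_triangle[of k j i] endo_comp[OF e, of "\<gamma> k j" "\<gamma> j i"] hji hkj dist by simp
  note x'_loop = tr_x_pushforward[OF C \<rho>(1) e]
  note eval = endo_comp[OF e] endo_source[OF e] endo_target[OF e] hloop w_ends reps_gcomp[OF r]
    reps_ginv[OF r] \<rho>w normalized_gamma[OF r \<rho>(2)] dist A_def[symmetric] B_def[symmetric]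
    D_def[symmetric]

  show "x' i j = x i j"
    unfolding x_def x'_def x'_loop[OF dist(1)] coords(3)
    by (simp add: eval hij hji del: \<gamma>.simps)
  have "x' j k = trace (B ** (matrix_inv (A ** B) ** D ** (A ** B)))"
    unfolding x'_def x'_loop[OF dist(2)]
    by (simp add: eval hjk hkj matrix_mul_assoc del: \<gamma>.simps)
  then show "x' j k = - x i j * x i k - x j k + s"
    unfolding trace_braid_SL2(1)[OF A B] x_def coords s by (simp only: A_def B_def D_def)
  have "x' i k = trace (A ** (matrix_inv (A ** B) ** D ** (A ** B)))"
    unfolding x'_def x'_loop[OF dist(3)]
    by (simp add: eval hik hki matrix_mul_assoc del: \<gamma>.simps)
  then show "x' i k = (x i j)\<^sup>2 * x i k + x i j * x j k - x i k - x i j * s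
      + (tr_a C i * tr_a C k + tr_a C j * tr_a4 C)"
    unfolding trace_braid_SL2(2)[OF A B] x_def coords(1,3) a4 s by (simp only: A_def B_def D_def)
qed

theorem proposition2p9:
  fixes C :: "(arrow \<Rightarrow> complex^2^2) set"
  assumes "C \<in> rep_classes"
  shows
    "let a1 = tr_a C S1; a2 = tr_a C S2; a3 = tr_a C S3; a4 = tr_a4 C; x = tr_x C in
     (let x' = tr_x (pushforward h1 C) in
        x' S1 S2 = x S1 S2 \<and>
        x' S2 S3 = - x S1 S2 * x S1 S3 - x S2 S3 + (a1 * a4 + a2 * a3) \<and>
        x' S1 S3 = (x S1 S2)\<^sup>2 * x S1 S3 + x S1 S2 * x S2 S3 - x S1 S3
                   - x S1 S2 * (a1 * a4 + a2 * a3) + (a1 * a3 + a2 * a4)) \<and>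
     (let x' = tr_x (pushforward h2 C) in
        x' S2 S3 = x S2 S3 \<and>
        x' S3 S1 = - x S2 S3 * x S2 S1 - x S3 S1 + (a2 * a4 + a3 * a1) \<and>
        x' S2 S1 = (x S2 S3)\<^sup>2 * x S2 S1 + x S2 S3 * x S3 S1 - x S2 S1
                   - x S2 S3 * (a2 * a4 + a3 * a1) + (a2 * a1 + a3 * a4)) \<and>
     (let x' = tr_x (pushforward h3 C) in
        x' S3 S1 = x S3 S1 \<and>
        x' S1 S2 = - x S3 S1 * x S3 S2 - x S1 S2 + (a3 * a4 + a1 * a2) \<and>
        x' S3 S2 = (x S3 S1)\<^sup>2 * x S3 S2 + x S3 S1 * x S1 S2 - x S3 S2
                   - x S3 S1 * (a3 * a4 + a1 * a2) + (a3 * a2 + a1 * a4))"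
  unfolding Let_def
  using braid_aut_trace_coords[OF assms braid_aut_h1] braid_aut_trace_coords[OF assms braid_aut_h2]
    braid_aut_trace_coords[OF assms braid_aut_h3]
  by simp

end
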